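(* The outer-level procedure (the Outer-loop Algorithm described in the context) converges to an optimal solution of the two-stage robust problem $$(\mathcal P_1)\qquad \min_{\mathbf s\in\Omega_1}\ \Big\{\sum_{j,t}\delta p_j^ts_j^t+\sum_t\delta p_0^ts_0^t+\max_{\lambda\in\mathcal D_2}\ \min_{(\mathbf q,\mathbf z,\mathbf x,\mathbf y)\in\Omega_2(\mathbf s,\lambda)}F(\mathbf q,\mathbf z,\mathbf x,\mathbf y)\Big\}$$ in a finite number of iterations, and the number of iterations is bounded by $K$, where $K=|\mathcal D^*|$ is the number of extreme points of $\mathcal D_2$.
   Context: **Data.** Finite index sets: $\mathcal I$ (access points, index $i$), $\mathcal J$ (edge nodes, indices $j,m$), $\mathcal T=\{1,\dots,T\}$ (time periods, index $t$). The index $0$ denotes the cloud. Given nonnegative parameters: slot length $\delta>0$; reserved prices $p_j^t,p_0^t$; buy-more prices $e_j^t,e_0^t$; sell-back prices $a_j^t,a_0^t$, with $e_j^t\ge p_j^t\ge a_j^t$ and $e_0^t\ge p_0^t\ge a_0^t$; installation costs $f_j^t$; storage costs $f_{j,t}^{\sf s}$; download costs $h_{m,j}^t$ (edge node $m$ to edge node $j$) and $h_{0,j}^t$ (cloud to $j$); capacities $C_j$; resource per request $w$; initial placement $z_j^0\in\{0,1\}$; workload costs $c_{i,j}=\rho d_{i,j}+\beta b H_{i,j}$ and $c_{i,0}=\rho d_{i,0}+\beta b H_{i,0}$, where $\rho$ is the delay penalty, $d$ the network delay, $\beta$ the unit bandwidth price, $b$ the request data size and $H$ the number of network hops. **First stage.**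 $\mathbf s=(s_j^t,s_0^t)$ belongs to $\Omega_1$ if $s_0^t\ge 0$ and $0\le s_j^t\le C_j$ for all $j,t$. **Uncertainty set.** $\mathcal D_2$ is the set of demand vectors $\lambda=(\lambda_i^t)_{i,t}$ for which there are $g_i^t\in[-1,1]$ with $\sum_{i}|g_i^t|\le\Gamma_1$ for all $t$, such that $\lambda_i^t=\bar\lambda_i^t+\tilde\lambda_i^t$ and $\tilde\lambda_i^t=\sum_{s=1}^{L}A_i^s\tilde\lambda_i^{t-s}+B_i g_i^t$ for all $i,t$. Here the forecasts $\bar\lambda_i^t$, the coefficients $A_i^s,B_i$, the lag $L$, the integer budget $\Gamma_1$, and the past residuals $\tilde\lambda_i^{t}$ for $t\le 0$ are given. $\mathcal D^*=\{\lambda^1,\dots,\lambda^K\}$ denotes the finite set of extreme points of $\mathcal D_2$. **Second stage.** The variables are $\mathbf q=(q_{m,j}^t\ (m\ne j),\,q_{0,j}^t)$ and $\mathbf z=(z_j^t)$, all binary (download and placement), and the continuous nonnegative variables $\mathbf x=(x_{i,j}^t,x_{i,0}^t)$ (workload) and $\mathbf y=(y_{j,t}^B,y_{0,t}^B,y_{j,t}^S,y_{0,t}^S)$ (buy-more and sell-back amounts). The feasible set $\Omega_2(\mathbf s,\lambda)$ consists of all $(\mathbf q,\mathbf z,\mathbf x,\mathbf y)$ such that, for all $i,j,m,t$ as applicable: - $x_{i,0}^t+\sum_j x_{i,j}^t\ge\lambda_i^t$; - $s_j^t+y_{j,t}^B-y_{j,t}^S\le C_j z_j^t$, $\;y_{j,t}^S\le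 s_j^t$, $\;y_{0,t}^S\le s_0^t$; - $s_0^t+y_{0,t}^B-y_{0,t}^S\ge w\sum_i x_{i,0}^t$, $\;s_j^t+y_{j,t}^B-y_{j,t}^S\ge w\sum_i x_{i,j}^t$; - $\sum_{j\neq m}q_{m,j}^t\le z_m^{t-1}$, $\;\sum_{m\neq j}q_{m,j}^t+q_{0,j}^t\ge z_j^t-z_j^{t-1}$. The second-stage cost is $$F=\sum_{j,t}\sum_{m\ne j}h_{m,j}^tq_{m,j}^t+\sum_{j,t}h_{0,j}^tq_{0,j}^t+\sum_{j,t}\big(f_j^t(1-z_j^{t-1})+f_{j,t}^{\sf s}\big)z_j^t+\sum_{j,t}\delta\,[e_j^ty_{j,t}^B-a_j^ty_{j,t}^S]+\sum_t\delta\,[e_0^ty_{0,t}^B-a_0^ty_{0,t}^S]+\sum_{i,t}c_{i,0}x_{i,0}^t+\sum_{i,j,t}c_{i,j}x_{i,j}^t .$$ **Inner problem.** For $\hat{\mathbf s}\in\Omega_1$ put $Q(\hat{\mathbf s})=\max_{\lambda\in\mathcal D_2}\min_{(\mathbf q,\mathbf z,\mathbf x,\mathbf y)\in\Omega_2(\hat{\mathbf s},\lambda)}F$. Standing convention: the worst case in $Q(\hat{\mathbf s})$ is attained at an extreme point of $\mathcal D_2$ (so that $(\mathcal P_1)$ is equivalent to the problem in which $\mathcal D_2$ is replaced by $\mathcal D^*$). The inner-level procedure serves as an oracle: given $\hat{\mathbf s}$, it returns the value $Q(\hat{\mathbf s})$ and a worst-case scenario $\lambda^*\in\mathcal D^*$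 attaining it. **Outer-loop Algorithm.** Set $LB^{\rm outer}=-\infty$, $UB^{\rm outer}=+\infty$. Start with the scenario list consisting of an extreme point $\lambda^{1,*}\in\mathcal D^*$ maximizing the total demand $\sum_{i,t}\lambda_i^t$ over $\mathcal D_2$. Each iteration does the following. 1. (Outer-MP) With the current list $\lambda^{1,*},\dots,\lambda^{k,*}$, compute an optimal solution of $$\min\ \sum_{j,t}\delta p_j^ts_j^t+\sum_t\delta p_0^ts_0^t+\eta\quad\text{s.t.}\quad \mathbf s\in\Omega_1,\ \ \eta\ge F(\mathbf q^l,\mathbf z^l,\mathbf x^l,\mathbf y^l),\ \ (\mathbf q^l,\mathbf z^l,\mathbf x^l,\mathbf y^l)\in\Omega_2(\mathbf s,\lambda^{l,*}),\ \ l=1,\dots,k,$$ over $\mathbf s,\eta$ and a separate copy of the second-stage variables for each $l$. Let $\hat{\mathbf s}$ be the optimal first-stage part and set $LB^{\rm outer}$ to the optimal value. 2. Call the inner-level procedure at $\hat{\mathbf s}$ to get $Q(\hat{\mathbf s})$ and $\lambda^*$. Set $UB^{\rm outer}\leftarrow\min\{UB^{\rm outer},\ \sum_{j,t}\delta p_j^t\hat s_j^t+\sum_t\delta p_0^t\hat s_0^t+Q(\hat{\mathbf s})\}$ and append $\lambda^*$ to the list of scenarios. The iterations are repeated until convergence, meaning $UB^{\rm outer}=LB^{\rm outer}$. The output is the first-stage decision. *)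

theory Defs
  imports "HOL-Analysis.Analysis"
begin

section \<open>Data\<close>

text \<open>
  Access points, edge nodes and time periods are the elements of the finite types \<open>'i\<close>, \<open>'j\<close> and
  \<open>'t\<close>.  The periods are linearly ordered, and \<open>period\<close> identifies them with 1, ..., T, where T is
  the cardinality of \<open>'t\<close>.  The suffix \<open>_cloud\<close> marks index 0.
\<close>

definition period :: "'t::{finite,linorder} \<Rightarrow> nat" where
  "period t = card {..t}"

lemma period_strict_mono: "strict_mono (period :: 't::{finite,linorder} \<Rightarrow> nat)"
  unfolding strict_mono_def period_def by (auto intro!: psubset_card_mono)

lemma bij_betw_period:
  "bij_betw (period :: 't::{finite,linorder} \<Rightarrow> nat) UNIV {1..CARD('t)}"
proof -
  have inj: "inj (period :: 't \<Rightarrow> nat)"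
    by (rule strict_mono_imp_inj_on[OF period_strict_mono])
  have "range (period :: 't \<Rightarrow> nat) \<subseteq> {1..CARD('t)}"
    by (auto simp: period_def Suc_le_eq card_gt_0_iff intro!: card_mono)
  then have "range (period :: 't \<Rightarrow> nat) = {1..CARD('t)}"
    by (intro card_subset_eq) (auto simp: card_image[OF inj])
  with inj show ?thesis by (simp add: bij_betw_def)
qed

text \<open>Value at calendar time \<open>k\<close> of the series \<open>v\<close> over the periods, continued to the times up to
  0 by the history \<open>past\<close>; only times up to T are ever accessed.\<close>

definition at_time :: "(int \<Rightarrow> 'a) \<Rightarrow> ('t::{finite,linorder} \<Rightarrow> 'a) \<Rightarrow> int \<Rightarrow> 'a" where
  "at_time past v k = (if k \<le> 0 then past k else v (inv period (nat k)))"

record ('i, 'j, 't) edge_instance =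
  slot :: real  \<comment> \<open>slot length \<open>\<delta>\<close>\<close>
  p_edge :: "'j \<Rightarrow> 't \<Rightarrow> real"
  p_cloud :: "'t \<Rightarrow> real"
  e_edge :: "'j \<Rightarrow> 't \<Rightarrow> real"
  e_cloud :: "'t \<Rightarrow> real"
  a_edge :: "'j \<Rightarrow> 't \<Rightarrow> real"
  a_cloud :: "'t \<Rightarrow> real"
  f_inst :: "'j \<Rightarrow> 't \<Rightarrow> real"
  f_stor :: "'j \<Rightarrow> 't \<Rightarrow> real"
  h_edge :: "'j \<Rightarrow> 'j \<Rightarrow> 't \<Rightarrow> real"  \<comment> \<open>\<open>h_edge m j t\<close>: from \<open>m\<close> to \<open>j\<close>\<close>
  h_cloud :: "'j \<Rightarrow> 't \<Rightarrow> real"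
  capac :: "'j \<Rightarrow> real"
  res_req :: real  \<comment> \<open>resource per request \<open>w\<close>\<close>
  z_init :: "'j \<Rightarrow> real"
  delay_pen :: real  \<comment> \<open>\<open>\<rho>\<close>\<close>
  d_edge :: "'i \<Rightarrow> 'j \<Rightarrow> real"
  d_cloud :: "'i \<Rightarrow> real"
  bw_price :: real  \<comment> \<open>\<open>\<beta>\<close>\<close>
  req_size :: real  \<comment> \<open>\<open>b\<close>\<close>
  hops_edge :: "'i \<Rightarrow> 'j \<Rightarrow> nat"
  hops_cloud :: "'i \<Rightarrow> nat"
  forecast :: "'i \<Rightarrow> 't \<Rightarrow> real"
  ar_coef :: "'i \<Rightarrow> nat \<Rightarrow> real"  \<comment> \<open>\<open>ar_coef i s\<close> for lags \<open>s = 1, ..., ar_lag\<close>\<close>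
  ar_lag :: nat
  shock_coef :: "'i \<Rightarrow> real"  \<comment> \<open>\<open>B\<^sub>i\<close>\<close>
  budget :: nat  \<comment> \<open>\<open>\<Gamma>\<^sub>1\<close>\<close>
  past_resid :: "'i \<Rightarrow> int \<Rightarrow> real"  \<comment> \<open>residuals at times up to 0\<close>

definition valid_instance :: "('i, 'j, 't) edge_instance \<Rightarrow> bool" where
  "valid_instance P \<longleftrightarrow>
     0 < slot P \<and>
     (\<forall>j t. 0 \<le> a_edge P j t \<and> a_edge P j t \<le> p_edge P j t \<and> p_edge P j t \<le> e_edge P j t) \<and>
     (\<forall>t. 0 \<le> a_cloud P t \<and> a_cloud P t \<le> p_cloud P t \<and> p_cloud P t \<le> e_cloud P t) \<and>
     (\<forall>j t. 0 \<le> f_inst P j t \<and> 0 \<le> f_stor P j t) \<and>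
     (\<forall>m j t. m \<noteq> j \<longrightarrow> 0 \<le> h_edge P m j t) \<and>
     (\<forall>j t. 0 \<le> h_cloud P j t) \<and>
     (\<forall>j. 0 \<le> capac P j) \<and>
     0 \<le> res_req P \<and>
     (\<forall>j. z_init P j \<in> {0, 1}) \<and>
     0 \<le> delay_pen P \<and> 0 \<le> bw_price P \<and> 0 \<le> req_size P \<and>
     (\<forall>i j. 0 \<le> d_edge P i j) \<and> (\<forall>i. 0 \<le> d_cloud P i)"

definition c_edge :: "('i, 'j, 't) edge_instance \<Rightarrow> 'i \<Rightarrow> 'j \<Rightarrow> real" where
  "c_edge P i j = delay_pen P * d_edge P i j + bw_price P * req_size P * real (hops_edge P i j)"

definition c_cloud :: "('i, 'j, 't) edge_instance \<Rightarrow> 'i \<Rightarrow> real" where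
  "c_cloud P i = delay_pen P * d_cloud P i + bw_price P * req_size P * real (hops_cloud P i)"


section \<open>First stage\<close>

record ('j, 't) first_stage =
  s_edge :: "'j \<Rightarrow> 't \<Rightarrow> real"
  s_cloud :: "'t \<Rightarrow> real"

definition Omega1 :: "('i, 'j, 't) edge_instance \<Rightarrow> ('j, 't) first_stage set" where
  "Omega1 P = {s. (\<forall>t. 0 \<le> s_cloud s t) \<and> (\<forall>j t. 0 \<le> s_edge s j t \<and> s_edge s j t \<le> capac P j)}"

definition reserve_cost ::
  "('i, 'j::finite, 't::finite) edge_instance \<Rightarrow> ('j, 't) first_stage \<Rightarrow> real" where
  "reserve_cost P s =
     (\<Sum>j\<in>UNIV. \<Sum>t\<in>UNIV. slot P * p_edge P j t * s_edge s j t) +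
     (\<Sum>t\<in>UNIV. slot P * p_cloud P t * s_cloud s t)"


section \<open>Uncertainty set\<close>

text \<open>The demand of access point \<open>i\<close> in period \<open>t\<close> is \<open>lam $ i $ t\<close>.\<close>

type_synonym ('i, 't) demand = "real ^ 't ^ 'i"

definition D2 ::
  "('i::finite, 'j, 't::{finite,linorder}) edge_instance \<Rightarrow> ('i, 't) demand set" where
  "D2 P = {lam. \<exists>(g :: 'i \<Rightarrow> 't \<Rightarrow> real) (resid :: 'i \<Rightarrow> 't \<Rightarrow> real).
     (\<forall>i t. g i t \<in> {-1..1}) \<and>
     (\<forall>t. (\<Sum>i\<in>UNIV. \<bar>g i t\<bar>) \<le> real (budget P)) \<and>
     (\<forall>i t. lam $ i $ t = forecast P i t + resid i t) \<and>
     (\<forall>i t. resid i t =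
        (\<Sum>s=1..ar_lag P. ar_coef P i s * at_time (past_resid P i) (resid i) (int (period t) - int s))
        + shock_coef P i * g i t)}"

definition Dstar ::
  "('i::finite, 'j, 't::{finite,linorder}) edge_instance \<Rightarrow> ('i, 't) demand set" where
  "Dstar P = {lam. lam extreme_point_of D2 P}"

definition total_demand :: "('i::finite, 't::finite) demand \<Rightarrow> real" where
  "total_demand lam = (\<Sum>i\<in>UNIV. \<Sum>t\<in>UNIV. lam $ i $ t)"


section \<open>Second stage\<close>

text \<open>The entries \<open>q_edge r j j t\<close> are not variables of the problem; they occur in no constraint
  and no cost term.\<close>

record ('i, 'j, 't) recourse =
  q_edge :: "'j \<Rightarrow> 'j \<Rightarrow> 't \<Rightarrow> real"
  q_cloud :: "'j \<Rightarrow> 't \<Rightarrow> real"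
  z_plc :: "'j \<Rightarrow> 't \<Rightarrow> real"
  x_edge :: "'i \<Rightarrow> 'j \<Rightarrow> 't \<Rightarrow> real"
  x_cloud :: "'i \<Rightarrow> 't \<Rightarrow> real"
  yB_edge :: "'j \<Rightarrow> 't \<Rightarrow> real"
  yB_cloud :: "'t \<Rightarrow> real"
  yS_edge :: "'j \<Rightarrow> 't \<Rightarrow> real"
  yS_cloud :: "'t \<Rightarrow> real"

definition z_prev ::
  "('i, 'j, 't::{finite,linorder}) edge_instance \<Rightarrow> ('i, 'j, 't) recourse \<Rightarrow> 'j \<Rightarrow> 't \<Rightarrow> real" where
  "z_prev P r j t = at_time (\<lambda>_. z_init P j) (z_plc r j) (int (period t) - 1)"

definition Omega2 ::
  "('i::finite, 'j::finite, 't::{finite,linorder}) edge_instance \<Rightarrow> ('j, 't) first_stage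
     \<Rightarrow> ('i, 't) demand \<Rightarrow> ('i, 'j, 't) recourse set" where
  "Omega2 P s lam = {r.
     (\<forall>m j t. m \<noteq> j \<longrightarrow> q_edge r m j t \<in> {0, 1}) \<and>
     (\<forall>j t. q_cloud r j t \<in> {0, 1}) \<and>
     (\<forall>j t. z_plc r j t \<in> {0, 1}) \<and>
     (\<forall>i j t. 0 \<le> x_edge r i j t) \<and>
     (\<forall>i t. 0 \<le> x_cloud r i t) \<and>
     (\<forall>j t. 0 \<le> yB_edge r j t \<and> 0 \<le> yS_edge r j t) \<and>
     (\<forall>t. 0 \<le> yB_cloud r t \<and> 0 \<le> yS_cloud r t) \<and>
     (\<forall>i t. x_cloud r i t + (\<Sum>j\<in>UNIV. x_edge r i j t) \<ge> lam $ i $ t) \<and>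
     (\<forall>j t. s_edge s j t + yB_edge r j t - yS_edge r j t \<le> capac P j * z_plc r j t) \<and>
     (\<forall>j t. yS_edge r j t \<le> s_edge s j t) \<and>
     (\<forall>t. yS_cloud r t \<le> s_cloud s t) \<and>
     (\<forall>t. s_cloud s t + yB_cloud r t - yS_cloud r t \<ge> res_req P * (\<Sum>i\<in>UNIV. x_cloud r i t)) \<and>
     (\<forall>j t. s_edge s j t + yB_edge r j t - yS_edge r j t \<ge> res_req P * (\<Sum>i\<in>UNIV. x_edge r i j t)) \<and>
     (\<forall>m t. (\<Sum>j\<in>UNIV - {m}. q_edge r m j t) \<le> z_prev P r m t) \<and>
     (\<forall>j t. (\<Sum>m\<in>UNIV - {j}. q_edge r m j t) + q_cloud r j t \<ge> z_plc r j t - z_prev P r j t)}"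

definition second_cost ::
  "('i::finite, 'j::finite, 't::{finite,linorder}) edge_instance \<Rightarrow> ('i, 'j, 't) recourse \<Rightarrow> real" where
  "second_cost P r =
     (\<Sum>j\<in>UNIV. \<Sum>t\<in>UNIV. \<Sum>m\<in>UNIV - {j}. h_edge P m j t * q_edge r m j t) +
     (\<Sum>j\<in>UNIV. \<Sum>t\<in>UNIV. h_cloud P j t * q_cloud r j t) +
     (\<Sum>j\<in>UNIV. \<Sum>t\<in>UNIV. (f_inst P j t * (1 - z_prev P r j t) + f_stor P j t) * z_plc r j t) +
     (\<Sum>j\<in>UNIV. \<Sum>t\<in>UNIV. slot P * (e_edge P j t * yB_edge r j t - a_edge P j t * yS_edge r j t)) +
     (\<Sum>t\<in>UNIV. slot P * (e_cloud P t * yB_cloud r t - a_cloud P t * yS_cloud r t)) +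
     (\<Sum>i\<in>UNIV. \<Sum>t\<in>UNIV. c_cloud P i * x_cloud r i t) +
     (\<Sum>i\<in>UNIV. \<Sum>j\<in>UNIV. \<Sum>t\<in>UNIV. c_edge P i j * x_edge r i j t)"


section \<open>The robust problem\<close>

text \<open>Minima and maxima are written as INF and SUP in \<^typ>\<open>ereal\<close>, so that the values are
  meaningful without a prior proof of feasibility, boundedness or attainment.\<close>

definition recourse_value ::
  "('i::finite, 'j::finite, 't::{finite,linorder}) edge_instance \<Rightarrow> ('j, 't) first_stage
     \<Rightarrow> ('i, 't) demand \<Rightarrow> ereal" where
  "recourse_value P s lam = (INF r\<in>Omega2 P s lam. ereal (second_cost P r))"

definition Q ::
  "('i::finite, 'j::finite, 't::{finite,linorder}) edge_instance \<Rightarrow> ('j, 't) first_stage \<Rightarrow> ereal" where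
  "Q P s = (SUP lam\<in>D2 P. recourse_value P s lam)"

definition objective ::
  "('i::finite, 'j::finite, 't::{finite,linorder}) edge_instance \<Rightarrow> ('j, 't) first_stage \<Rightarrow> ereal" where
  "objective P s = ereal (reserve_cost P s) + Q P s"

definition optimal_P1 ::
  "('i::finite, 'j::finite, 't::{finite,linorder}) edge_instance \<Rightarrow> ('j, 't) first_stage \<Rightarrow> bool" where
  "optimal_P1 P s \<longleftrightarrow> s \<in> Omega1 P \<and> (\<forall>s'\<in>Omega1 P. objective P s \<le> objective P s')"

text \<open>This does not follow from the model: because of the binary variables, the recourse value is
  not a convex function of the demand.\<close>

definition worst_case_at_extreme_point ::
  "('i::finite, 'j::finite, 't::{finite,linorder}) edge_instance \<Rightarrow> bool" where
  "worst_case_at_extreme_point P \<longleftrightarrow>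
     (\<forall>s\<in>Omega1 P. \<exists>lam\<in>Dstar P. \<forall>lam'\<in>D2 P. recourse_value P s lam' \<le> recourse_value P s lam)"


section \<open>The outer loop\<close>

text \<open>Feasible points of the master problem for the scenario list \<open>lams\<close>; the list \<open>rs\<close> holds one
  copy of the second-stage variables per scenario.\<close>

definition MP_feasible ::
  "('i::finite, 'j::finite, 't::{finite,linorder}) edge_instance \<Rightarrow> ('i, 't) demand list
     \<Rightarrow> ('j, 't) first_stage \<Rightarrow> real \<Rightarrow> ('i, 'j, 't) recourse list \<Rightarrow> bool" where
  "MP_feasible P lams s \<eta> rs \<longleftrightarrow>
     s \<in> Omega1 P \<and> list_all2 (\<lambda>r lam. second_cost P r \<le> \<eta> \<and> r \<in> Omega2 P s lam) rs lams"

definition MP_optimal ::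
  "('i::finite, 'j::finite, 't::{finite,linorder}) edge_instance \<Rightarrow> ('i, 't) demand list
     \<Rightarrow> ('j, 't) first_stage \<Rightarrow> real \<Rightarrow> ('i, 'j, 't) recourse list \<Rightarrow> bool" where
  "MP_optimal P lams s \<eta> rs \<longleftrightarrow>
     MP_feasible P lams s \<eta> rs \<and>
     (\<forall>s' \<eta>' rs'. MP_feasible P lams s' \<eta>' rs' \<longrightarrow> reserve_cost P s + \<eta> \<le> reserve_cost P s' + \<eta>')"

text \<open>The field \<open>trials\<close> records the first-stage decisions produced so far.\<close>

record ('i, 'j, 't) outer_state =
  scens :: "('i, 't) demand list"
  LB_outer :: ereal
  UB_outer :: ereal
  trials :: "('j, 't) first_stage list"

definition outer_init ::
  "('i::finite, 'j::finite, 't::{finite,linorder}) edge_instance \<Rightarrow> ('i, 'j, 't) outer_state \<Rightarrow> bool" where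
  "outer_init P st \<longleftrightarrow>
     (\<exists>lam\<in>Dstar P. (\<forall>lam'\<in>D2 P. total_demand lam' \<le> total_demand lam) \<and>
        st = \<lparr>scens = [lam], LB_outer = -\<infinity>, UB_outer = \<infinity>, trials = []\<rparr>)"

definition converged :: "('i, 'j, 't) outer_state \<Rightarrow> bool" where
  "converged st \<longleftrightarrow> UB_outer st = LB_outer st"

text \<open>One iteration.  Any optimal solution of the master problem and any worst-case scenario in
  \<open>Dstar\<close> may be chosen.\<close>

definition outer_step ::
  "('i::finite, 'j::finite, 't::{finite,linorder}) edge_instance
     \<Rightarrow> ('i, 'j, 't) outer_state \<Rightarrow> ('i, 'j, 't) outer_state \<Rightarrow> bool" where
  "outer_step P st st' \<longleftrightarrow>
     \<not> converged st \<and>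
     (\<exists>s \<eta> rs lam.
        MP_optimal P (scens st) s \<eta> rs \<and>
        lam \<in> Dstar P \<and> recourse_value P s lam = Q P s \<and>
        st' = \<lparr>scens = scens st @ [lam],
               LB_outer = ereal (reserve_cost P s + \<eta>),
               UB_outer = min (UB_outer st) (ereal (reserve_cost P s) + Q P s),
               trials = trials st @ [s]\<rparr>)"

text \<open>The output is a first-stage decision attaining the upper bound.  The last master solution need
  not attain it: the minimum in the update of \<open>UB_outer\<close> may stem from an earlier iteration.\<close>

definition outer_output ::
  "('i::finite, 'j::finite, 't::{finite,linorder}) edge_instance
     \<Rightarrow> ('i, 'j, 't) outer_state \<Rightarrow> ('j, 't) first_stage \<Rightarrow> bool" where
  "outer_output P st s \<longleftrightarrow> s \<in> set (trials st) \<and> objective P s = UB_outer st"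

end

theory Submission
  imports Defs
begin

text \<open>
  The master problem ranges over a sublist of the scenarios in \<open>D2 P\<close>, so its value never exceeds the
  optimum of the robust problem, while every trial decision bounds that optimum from above.  If the
  oracle returns a scenario that is already listed, the master constraint for it gives
  \<open>Q P s \<le> \<eta>\<close> and the two bounds meet.  Hence all scenarios seen before convergence are distinct
  points of \<open>Dstar P\<close>, which is finite because \<open>D2 P\<close> is an affine image of a polytope of shocks.

  The procedure never gets stuck because the master problem attains its minimum: workloads, cloud
  reservation and cloud purchases can be truncated at a common bound without raising the cost, which
  leaves a continuous function on a compact set.
\<close>

section \<open>The demand set as a polytope with finitely many extreme points\<close>

lemma polyhedron_linear_le:
  fixes f :: "'a::euclidean_space \<Rightarrow> real"
  assumes "linear f"
  shows "polyhedron {x. f x \<le> b}"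
proof -
  \<comment> \<open>The Riesz vector of \<open>f\<close>, which puts the set in halfspace
    form.\<close>
  have "f x = adjoint f 1 \<bullet> x" for x
    using adjoint_works[OF assms, of x 1] by (simp add: inner_commute)
  then show ?thesis
    using polyhedron_halfspace_le[of "adjoint f 1" b] by simp
qed

lemma polyhedron_INT:
  fixes A :: "'a::finite \<Rightarrow> 'b::euclidean_space set"
  shows "(\<And>i. polyhedron (A i)) \<Longrightarrow> polyhedron (\<Inter>i. A i)"
  by auto

text \<open>Triangularity of the recursion: a positive lag reaches either the zero history or a
  strictly earlier period, because \<open>period\<close> is strictly increasing and onto 1, ...,
  T.\<close>

lemma at_time_less:
  fixes t :: "'t::{finite,linorder}"
  assumes "1 \<le> s" and v: "\<And>t'. t' < t \<Longrightarrow> v t' = 0"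
  shows "at_time (\<lambda>_. 0::real) v (int (period t) - int s) = 0"
proof (cases "int (period t) - int s \<le> 0")
  case False
  define k where "k = nat (int (period t) - int s)"
  have "period t \<in> {1..CARD('t)}"
    using bij_betw_period[where 't='t] by (auto simp: bij_betw_def)
  then have "k \<in> {1..CARD('t)}" and kt: "k < period t"
    using False \<open>1 \<le> s\<close> by (auto simp: k_def)
  then have "k \<in> range (period :: 't \<Rightarrow> nat)"
    using bij_betw_period[where 't='t] by (simp add: bij_betw_def)
  then have "period (inv period k :: 't) = k"
    by (rule f_inv_into_f)
  with kt have "(inv period k :: 't) < t"
    using strict_mono_less[OF period_strict_mono, of "inv period k" t] by simp
  with v False show ?thesis
    by (simp add: at_time_def k_def)
qed (simp add: at_time_def)

text \<open>The residual recursion reads \<open>ar_map P resid = c + B g\<close>, with the history in the constant \<open>c\<close>.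
  It is uniquely solvable because \<open>ar_map P\<close> is unitriangular in time.\<close>

definition ar_map ::
  "('i::finite, 'j, 't::{finite,linorder}) edge_instance \<Rightarrow> ('i, 't) demand \<Rightarrow> ('i, 't) demand" where
  "ar_map P x = (\<chi> i t. x $ i $ t -
     (\<Sum>s=1..ar_lag P. ar_coef P i s * at_time (\<lambda>_. 0) (\<lambda>t. x $ i $ t) (int (period t) - int s)))"

lemma linear_ar_map: "linear (ar_map P)"
proof (rule linearI)
  show "ar_map P (x + y) = ar_map P x + ar_map P y" for x y
    by (auto simp: ar_map_def vec_eq_iff at_time_def sum.distrib[symmetric] algebra_simps
        intro!: sum.cong)
  show "ar_map P (c *\<^sub>R x) = c *\<^sub>R ar_map P x" for c x
    by (auto simp: ar_map_def vec_eq_iff at_time_def sum_distrib_left algebra_simps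
        intro!: sum.cong)
qed

lemma inj_ar_map:
  fixes P :: "('i::finite, 'j, 't::{finite,linorder}) edge_instance"
  shows "inj (ar_map P)"
  unfolding linear_injective_0[OF linear_ar_map]
proof (intro allI impI)
  fix x assume 0: "ar_map P x = 0"
  have "x $ i $ t = 0" for i t
  proof (induction t rule: measure_induct_rule[where f = period])
    case (less t)
    \<comment> \<open>Forward substitution in time: once the lagged entries vanish, the equation at
      \<open>t\<close> reads \<open>x $ i $ t = 0\<close>.\<close>
    have "at_time (\<lambda>_. 0) (\<lambda>t. x $ i $ t) (int (period t) - int s) = 0" if "s \<in> {1..ar_lag P}" for s
      using that less strict_monoD[OF period_strict_mono] by (intro at_time_less) auto
    moreover have "ar_map P x $ i $ t = 0"
      by (simp add: 0)
    ultimately show ?case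
      by (simp add: ar_map_def)
  qed
  then show "x = 0"
    by (simp add: vec_eq_iff)
qed

definition shocks :: "nat \<Rightarrow> ('i::finite, 't::finite) demand set" where
  "shocks b = {g. (\<forall>i t. g $ i $ t \<in> {-1..1}) \<and> (\<forall>t. (\<Sum>i\<in>UNIV. \<bar>g $ i $ t\<bar>) \<le> real b)}"

text \<open>The l1 ball is cut out by one linear inequality per sign pattern; the tightest pattern
  takes \<open>S\<close> to be the indices with nonnegative entry.\<close>

lemma sum_abs_le_iff_signs:
  fixes x :: "'i::finite \<Rightarrow> real"
  shows "(\<Sum>i\<in>UNIV. \<bar>x i\<bar>) \<le> b \<longleftrightarrow> (\<forall>S. (\<Sum>i\<in>UNIV. (if i \<in> S then x i else - x i)) \<le> b)"
proof
  assume "(\<Sum>i\<in>UNIV. \<bar>x i\<bar>) \<le> b"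
  moreover have "(\<Sum>i\<in>UNIV. (if i \<in> S then x i else - x i)) \<le> (\<Sum>i\<in>UNIV. \<bar>x i\<bar>)" for S
    by (intro sum_mono) auto
  ultimately show "\<forall>S. (\<Sum>i\<in>UNIV. (if i \<in> S then x i else - x i)) \<le> b"
    by (meson order_trans)
next
  assume "\<forall>S. (\<Sum>i\<in>UNIV. (if i \<in> S then x i else - x i)) \<le> b"
  then have "(\<Sum>i\<in>UNIV. (if i \<in> {i. 0 \<le> x i} then x i else - x i)) \<le> b"
    by blast
  then show "(\<Sum>i\<in>UNIV. \<bar>x i\<bar>) \<le> b"
    by (simp add: abs_if not_le[symmetric] if_distrib cong: if_cong) (smt (verit) sum.cong)
qed

text \<open>Box constraints and sign patterns give finitely many halfspaces, and the box supplies
  boundedness.\<close>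

lemma polytope_shocks: "polytope (shocks b :: ('i::finite, 't::finite) demand set)"
proof -
  have eq: "(shocks b :: ('i, 't) demand set) =
      (\<Inter>i. \<Inter>t. {g. g $ i $ t \<le> 1} \<inter> {g. - (g $ i $ t) \<le> 1}) \<inter>
      (\<Inter>t. \<Inter>S. {g. (\<Sum>i\<in>UNIV. (if i \<in> S then g $ i $ t else - g $ i $ t)) \<le> real b})"
    unfolding shocks_def sum_abs_le_iff_signs by fastforce
  have "polyhedron (shocks b :: ('i, 't) demand set)"
    unfolding eq
    by (intro polyhedron_Int polyhedron_INT polyhedron_linear_le linearI)
      (auto simp: sum.distrib[symmetric] sum_distrib_left intro!: sum.cong)
  moreover have "bounded (shocks b :: ('i, 't) demand set)"
    by (rule bounded_subset[OF bounded_closed_interval, of _ "\<chi> i t. -1" "\<chi> i t. 1"])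
      (auto simp: shocks_def less_eq_vec_def)
  ultimately show ?thesis
    by (simp add: polytope_eq_bounded_polyhedron)
qed

text \<open>Inverting \<open>ar_map P\<close> solves the recursion explicitly for the residuals, so
  a demand is a linear image of the shocks plus a constant from forecast and history.\<close>

theorem polytope_D2: "polytope (D2 P)"
  for P :: "('i::finite, 'j, 't::{finite,linorder}) edge_instance"
proof -
  obtain L where L: "linear L" "\<And>x. L (ar_map P x) = x" "\<And>x. ar_map P (L x) = x"
    using linear_injective_isomorphism[OF linear_ar_map inj_ar_map, of P] by blast
  define B where "B g = (\<chi> i t. shock_coef P i * g $ i $ t)" for g :: "('i, 't) demand"
  define c :: "('i, 't) demand" where "c = (\<chi> i t. \<Sum>s=1..ar_lag P.
    ar_coef P i s * at_time (past_resid P i) (\<lambda>_::'t. 0) (int (period t) - int s))"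
  define fc :: "('i, 't) demand" where "fc = (\<chi> i t. forecast P i t)"
  have lin: "linear B"
    by (rule linearI) (auto simp: B_def vec_eq_iff algebra_simps)
  \<comment> \<open>Each lagged access hits either the history or the current series; filling the
    other one with zeros splits the sum.\<close>
  have split: "(\<Sum>s=1..ar_lag P. ar_coef P i s *
        at_time (past_resid P i) (\<lambda>t. y $ i $ t) (int (period t) - int s)) =
      c $ i $ t + (\<Sum>s=1..ar_lag P. ar_coef P i s *
        at_time (\<lambda>_. 0) (\<lambda>t. y $ i $ t) (int (period t) - int s))"
    for y :: "('i, 't) demand" and i t
    by (auto simp: c_def at_time_def sum.distrib[symmetric] intro!: sum.cong)
  have rec: "(\<forall>i t. y $ i $ t =
        (\<Sum>s=1..ar_lag P. ar_coef P i s * at_time (past_resid P i) (\<lambda>t. y $ i $ t) (int (period t) - int s))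
        + shock_coef P i * g $ i $ t) \<longleftrightarrow> ar_map P y = c + B g" for y g
    unfolding split by (auto simp: vec_eq_iff ar_map_def B_def algebra_simps)
  have "ar_map P y = c + B g \<longleftrightarrow> y = L c + L (B g)" for y g
    by (metis L linear_add)
  note rec = rec[unfolded this]
  have "lam \<in> D2 P \<longleftrightarrow> (\<exists>g\<in>shocks (budget P). lam = (fc + L c) + (L \<circ> B) g)" for lam
  proof
    assume "lam \<in> D2 P"
    then obtain g r where gr: "\<forall>i t. g i t \<in> {-1..1}"
      "\<forall>t. (\<Sum>i\<in>UNIV. \<bar>g i t\<bar>) \<le> real (budget P)"
      "\<forall>i t. lam $ i $ t = forecast P i t + r i t"
      "\<forall>i t. r i t =
        (\<Sum>s=1..ar_lag P. ar_coef P i s * at_time (past_resid P i) (r i) (int (period t) - int s))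
        + shock_coef P i * g i t"
      unfolding D2_def by blast
    have "(\<chi> i t. g i t) \<in> shocks (budget P)"
      using gr by (simp add: shocks_def)
    moreover have "(\<chi> i t. r i t) = L c + L (B (\<chi> i t. g i t))"
      by (rule rec[THEN iffD1]) (unfold vec_lambda_beta, rule gr(4))
    then have "lam = (fc + L c) + (L \<circ> B) (\<chi> i t. g i t)"
      using gr(3) by (simp add: vec_eq_iff fc_def)
    ultimately show "\<exists>g\<in>shocks (budget P). lam = (fc + L c) + (L \<circ> B) g"
      by blast
  next
    assume "\<exists>g\<in>shocks (budget P). lam = (fc + L c) + (L \<circ> B) g"
    then obtain g where g: "g \<in> shocks (budget P)" "lam = fc + (L c + L (B g))"
      by (auto simp: add.assoc)
    define y where "y = L c + L (B g)"
    have lam: "\<forall>i t. lam $ i $ t = forecast P i t + y $ i $ t"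
      by (simp add: g(2) y_def[symmetric] fc_def)
    have "\<forall>i t. g $ i $ t \<in> {-1..1}" "\<forall>t. (\<Sum>i\<in>UNIV. \<bar>g $ i $ t\<bar>) \<le> real (budget P)"
      using g(1) by (simp_all add: shocks_def)
    then show "lam \<in> D2 P"
      unfolding D2_def mem_Collect_eq
      by (intro exI[where x = "\<lambda>i t. g $ i $ t"] exI[where x = "\<lambda>i t. y $ i $ t"] conjI
          lam rec[THEN iffD2, OF y_def])
  qed
  then have "D2 P = (\<lambda>x. (fc + L c) + x) ` ((L \<circ> B) ` shocks (budget P))"
    by (auto simp: image_iff)
  then show ?thesis
    using polytope_linear_image[OF linear_compose[OF lin L(1)] polytope_shocks]
    by (simp only: polytope_translation_eq)
qed

lemma finite_Dstar: "finite (Dstar P)"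
  for P :: "('i::finite, 'j, 't::{finite,linorder}) edge_instance"
  unfolding Dstar_def
  using polytope_D2[of P] by (intro finite_polyhedron_extreme_points) (rule polytope_imp_polyhedron)

lemma Dstar_subset_D2: "Dstar P \<subseteq> D2 P"
  for P :: "('i::finite, 'j, 't::{finite,linorder}) edge_instance"
  by (auto simp: Dstar_def extreme_point_of_def)

text \<open>By Krein-Milman \<open>D2 P\<close> is the hull of its extreme points, and a linear
  function on a hull is bounded by its maximum on the generators. This provides the initial scenario
  of the loop.\<close>

lemma total_demand_max_at_Dstar:
  fixes P :: "('i::finite, 'j, 't::{finite,linorder}) edge_instance"
  assumes "Dstar P \<noteq> {}"
  shows "\<exists>lam\<in>Dstar P. \<forall>lam'\<in>D2 P. total_demand lam' \<le> total_demand lam"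
proof -
  have lin: "linear (total_demand :: ('i, 't) demand \<Rightarrow> real)"
    by (rule linearI) (auto simp: total_demand_def sum.distrib sum_distrib_left)
  obtain lam where lam: "lam \<in> Dstar P" "\<And>l. l \<in> Dstar P \<Longrightarrow> total_demand l \<le> total_demand lam"
    using finite_Dstar[of P] assms obtains_MAX[of "Dstar P" total_demand] by (metis Max_ge finite_imageI imageI)
  have hull: "D2 P = convex hull (Dstar P)"
    unfolding Dstar_def using polytope_D2[of P]
    by (intro Krein_Milman_Minkowski polytope_imp_compact polytope_imp_convex)
  have convex: "convex_on (convex hull (Dstar P)) (total_demand :: ('i, 't) demand \<Rightarrow> real)"
    by (auto simp: convex_on_def linear_add[OF lin] linear_cmul[OF lin])
  have "total_demand l \<le> total_demand lam" if "l \<in> D2 P" for l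
    using convex_on_convex_hull_bound[of "Dstar P" total_demand "total_demand lam"]
      lam(2) that hull convex by metis
  with lam(1) show ?thesis
    by blast
qed

section \<open>Feasibility of the second stage and attainment in the master problem\<close>

lemma Omega2_nonempty:
  fixes P :: "('i::finite, 'j::finite, 't::{finite,linorder}) edge_instance"
  assumes P: "valid_instance P" and s: "s \<in> Omega1 P"
  shows "Omega2 P s lam \<noteq> {}"
proof -
  \<comment> \<open>Place nothing, sell back all edge reservations and serve the whole demand from
    extra cloud purchases.\<close>
  define r :: "('i, 'j, 't) recourse" where "r =
    \<lparr>q_edge = \<lambda>_ _ _. 0, q_cloud = \<lambda>_ _. 0, z_plc = \<lambda>_ _. 0,
     x_edge = \<lambda>_ _ _. 0, x_cloud = \<lambda>i t. max 0 (lam $ i $ t),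
     yB_edge = \<lambda>_ _. 0, yB_cloud = \<lambda>t. res_req P * (\<Sum>i\<in>UNIV. max 0 (lam $ i $ t)),
     yS_edge = s_edge s, yS_cloud = \<lambda>_. 0\<rparr>"
  \<comment> \<open>With no downloads and no placement, both download constraints reduce to this
    inequality; the first period uses \<open>z_init\<close>.\<close>
  have "0 \<le> z_prev P r m t" for m t
    using P by (auto simp: z_prev_def at_time_def r_def valid_instance_def)
      (metis order.refl zero_le_one)
  moreover have "0 \<le> res_req P * (\<Sum>i\<in>UNIV. max 0 (lam $ i $ t))" for t
    using P by (intro mult_nonneg_nonneg sum_nonneg) (auto simp: valid_instance_def)
  ultimately have "r \<in> Omega2 P s lam"
    using s by (auto simp: Omega2_def Omega1_def r_def)
  then show ?thesis
    by blast
qed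

text \<open>A cut of the cloud reservation by \<open>d\<close> is matched by selling back up to \<open>d\<close> less; since
  \<open>a_cloud \<le> p_cloud\<close>, the savings on the reservation cover the lost revenue.\<close>

lemma truncate_master_point:
  fixes P :: "('i::finite, 'j::finite, 't::{finite,linorder}) edge_instance"
  assumes P: "valid_instance P" and s: "s \<in> Omega1 P"
    and L: "0 \<le> L" and M: "M = res_req P * (real CARD('i) * L)"
    and s': "s' = s\<lparr>s_cloud := \<lambda>t. min (s_cloud s t) M\<rparr>"
    and r: "r \<in> Omega2 P s lam" and lam: "\<And>i t. lam $ i $ t \<le> L"
    and r': "r' = r\<lparr>q_edge := \<lambda>m j t. if m = j then 0 else q_edge r m j t,
      x_edge := \<lambda>i j t. min (x_edge r i j t) L,
      x_cloud := \<lambda>i t. min (x_cloud r i t) L,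
      yB_cloud := \<lambda>t. min (yB_cloud r t) M,
      yS_cloud := \<lambda>t. max 0 (yS_cloud r t - (s_cloud s t - s_cloud s' t))\<rparr>"
  shows "r' \<in> Omega2 P s' lam"
    and "second_cost P r' \<le> second_cost P r + (reserve_cost P s - reserve_cost P s')"
proof -
  have zp: "z_prev P r' = z_prev P r"
    by (simp add: r' z_prev_def fun_eq_iff)
  have M0: "0 \<le> M"
    using P L by (simp add: M valid_instance_def)
  have x0: "0 \<le> x_edge r i j t" "0 \<le> x_cloud r i t" for i j t
    using r by (auto simp: Omega2_def)
  have w0: "0 \<le> res_req P"
    using P by (simp add: valid_instance_def)
  \<comment> \<open>Either nothing is cut and the old inequality survives, or some truncated
    workload equals \<open>L\<close>, which alone covers the demand.\<close>
  have demand: "lam $ i $ t \<le> x_cloud r' i t + (\<Sum>j\<in>UNIV. x_edge r' i j t)" for i t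
  proof (cases "x_cloud r i t \<le> L \<and> (\<forall>j. x_edge r i j t \<le> L)")
    case True
    then have "x_cloud r' i t = x_cloud r i t" "\<And>j. x_edge r' i j t = x_edge r i j t"
      by (auto simp: r' min_def)
    then show ?thesis
      using r by (auto simp: Omega2_def)
  next
    case False
    then consider "L \<le> x_cloud r i t" | j where "L \<le> x_edge r i j t"
      by (meson linear)
    then show ?thesis
    proof cases
      case 1
      then have "L \<le> x_cloud r' i t"
        by (simp add: r')
      moreover have "0 \<le> (\<Sum>j\<in>UNIV. x_edge r' i j t)"
        using x0 L by (auto simp: r' intro!: sum_nonneg)
      ultimately show ?thesis
        using lam[of i t] by linarith
    next
      case (2 j)
      then have "L \<le> x_edge r' i j t"
        by (simp add: r')
      moreover have "x_edge r' i j t \<le> (\<Sum>j\<in>UNIV. x_edge r' i j t)"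
        using x0 L by (intro member_le_sum) (auto simp: r')
      moreover have "0 \<le> x_cloud r' i t"
        using x0 L by (simp add: r')
      ultimately show ?thesis
        using lam[of i t] by linarith
    qed
  qed
  have edge: "res_req P * (\<Sum>i\<in>UNIV. x_edge r' i j t) \<le> res_req P * (\<Sum>i\<in>UNIV. x_edge r i j t)" for j t
    using w0 by (intro mult_left_mono sum_mono) (auto simp: r')
  have cloud1: "res_req P * (\<Sum>i\<in>UNIV. x_cloud r' i t) \<le> res_req P * (\<Sum>i\<in>UNIV. x_cloud r i t)" for t
    using w0 by (intro mult_left_mono sum_mono) (auto simp: r')
  \<comment> \<open>\<open>M\<close> is the resource needed if every access point sends
    \<open>L\<close> to the cloud.\<close>
  have cloud2: "res_req P * (\<Sum>i\<in>UNIV. x_cloud r' i t) \<le> M" for t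
    unfolding M using w0 by (intro mult_left_mono sum_bounded_above) (auto simp: r')
  \<comment> \<open>If the new sale is zero, reservation plus purchase is either uncut or at least
    \<open>M\<close>. If it is positive, the cut of the reservation cancels, leaving the old net
    reservation plus a purchase that is uncut or equal to \<open>M\<close>.\<close>
  have cloud: "res_req P * (\<Sum>i\<in>UNIV. x_cloud r' i t) \<le> s_cloud s' t + yB_cloud r' t - yS_cloud r' t"
    "yS_cloud r' t \<le> s_cloud s' t" for t
  proof -
    have "0 \<le> yB_cloud r t" "0 \<le> yS_cloud r t" "yS_cloud r t \<le> s_cloud s t" "0 \<le> s_cloud s t"
      "res_req P * (\<Sum>i\<in>UNIV. x_cloud r i t) \<le> s_cloud s t + yB_cloud r t - yS_cloud r t"
      using r s by (auto simp: Omega2_def Omega1_def)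
    moreover have "s_cloud s' t = min (s_cloud s t) M" "yB_cloud r' t = min (yB_cloud r t) M"
      "yS_cloud r' t = max 0 (yS_cloud r t - (s_cloud s t - s_cloud s' t))"
      by (simp_all add: s' r')
    ultimately show "res_req P * (\<Sum>i\<in>UNIV. x_cloud r' i t) \<le> s_cloud s' t + yB_cloud r' t - yS_cloud r' t"
      "yS_cloud r' t \<le> s_cloud s' t"
      using cloud1[of t] cloud2[of t] M0 by linarith+
  qed
  \<comment> \<open>Clearing the diagonal keeps these sums and brings its unconstrained entries into
    a bounded box.\<close>
  have Q: "(\<Sum>j\<in>UNIV - {m}. q_edge r' m j t) = (\<Sum>j\<in>UNIV - {m}. q_edge r m j t)"
    "(\<Sum>m\<in>UNIV - {j}. q_edge r' m j t) = (\<Sum>m\<in>UNIV - {j}. q_edge r m j t)" for m j t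
    by (auto simp: r' intro!: sum.cong)
  have same: "q_cloud r' = q_cloud r" "z_plc r' = z_plc r" "yB_edge r' = yB_edge r"
    "yS_edge r' = yS_edge r" "s_edge s' = s_edge s"
    by (simp_all add: r' s')
  have nonneg: "0 \<le> x_edge r' i j t" "0 \<le> x_cloud r' i t" "0 \<le> yB_cloud r' t" "0 \<le> yS_cloud r' t"
    and q01: "m \<noteq> j \<Longrightarrow> q_edge r' m j t \<in> {0, 1}" for i j t m
    using r L M0 by (auto simp: r' Omega2_def)
  have edge': "res_req P * (\<Sum>i\<in>UNIV. x_edge r' i j t) \<le> s_edge s j t + yB_edge r j t - yS_edge r j t" for j t
    using r edge[of j t] order_trans by (fastforce simp: Omega2_def)
  have r0: "q_cloud r j t \<in> {0, 1}" "z_plc r j t \<in> {0, 1}" "0 \<le> yB_edge r j t" "0 \<le> yS_edge r j t"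
    "s_edge s j t + yB_edge r j t - yS_edge r j t \<le> capac P j * z_plc r j t"
    "yS_edge r j t \<le> s_edge s j t"
    "(\<Sum>m'\<in>UNIV - {j}. q_edge r j m' t) \<le> z_prev P r j t"
    "z_plc r j t - z_prev P r j t \<le> (\<Sum>m\<in>UNIV - {j}. q_edge r m j t) + q_cloud r j t" for j t
    using r by (simp_all add: Omega2_def)
  show "r' \<in> Omega2 P s' lam"
    unfolding Omega2_def mem_Collect_eq Q same zp
    by (intro conjI allI impI r0 demand edge' cloud nonneg q01)
  have a: "0 \<le> a_cloud P t" "a_cloud P t \<le> p_cloud P t" "0 \<le> e_cloud P t" "0 < slot P" for t
  proof -
    have "0 \<le> a_cloud P t" "a_cloud P t \<le> p_cloud P t" "p_cloud P t \<le> e_cloud P t" "0 < slot P"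
      using P by (simp_all add: valid_instance_def)
    then show "0 \<le> a_cloud P t" "a_cloud P t \<le> p_cloud P t" "0 \<le> e_cloud P t" "0 < slot P"
      by linarith+
  qed
  have c0: "0 \<le> c_edge P i j" "0 \<le> c_cloud P i" for i j
    using P by (auto simp: valid_instance_def c_edge_def c_cloud_def)
  have Qcost: "(\<Sum>j\<in>UNIV. \<Sum>t\<in>UNIV. \<Sum>m\<in>UNIV - {j}. h_edge P m j t * q_edge r' m j t) =
     (\<Sum>j\<in>UNIV. \<Sum>t\<in>UNIV. \<Sum>m\<in>UNIV - {j}. h_edge P m j t * q_edge r m j t)"
    by (auto simp: r' intro!: sum.cong)
  have X: "(\<Sum>i\<in>UNIV. \<Sum>t\<in>UNIV. c_cloud P i * x_cloud r' i t) \<le>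
      (\<Sum>i\<in>UNIV. \<Sum>t\<in>UNIV. c_cloud P i * x_cloud r i t)"
    "(\<Sum>i\<in>UNIV. \<Sum>j\<in>UNIV. \<Sum>t\<in>UNIV. c_edge P i j * x_edge r' i j t) \<le>
      (\<Sum>i\<in>UNIV. \<Sum>j\<in>UNIV. \<Sum>t\<in>UNIV. c_edge P i j * x_edge r i j t)"
    using c0 by (auto simp: r' intro!: sum_mono mult_left_mono)
  have "slot P * (e_cloud P t * yB_cloud r' t - a_cloud P t * yS_cloud r' t) \<le>
      slot P * (e_cloud P t * yB_cloud r t - a_cloud P t * yS_cloud r t) +
      (slot P * p_cloud P t * s_cloud s t - slot P * p_cloud P t * s_cloud s' t)" for t
  proof -
    define d where "d = s_cloud s t - s_cloud s' t"
    have "0 \<le> d"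
      by (simp add: d_def s')
    have "e_cloud P t * yB_cloud r' t \<le> e_cloud P t * yB_cloud r t"
      using a(3) by (intro mult_left_mono) (auto simp: r')
    moreover have "a_cloud P t * (yS_cloud r t - d) \<le> a_cloud P t * yS_cloud r' t"
      using a(1) by (intro mult_left_mono) (auto simp: r' d_def)
    moreover have "a_cloud P t * d \<le> p_cloud P t * d"
      using a \<open>0 \<le> d\<close> by (intro mult_right_mono)
    ultimately have "e_cloud P t * yB_cloud r' t - a_cloud P t * yS_cloud r' t \<le>
        e_cloud P t * yB_cloud r t - a_cloud P t * yS_cloud r t + p_cloud P t * d"
      by (simp add: algebra_simps)
    from mult_left_mono[OF this, of "slot P"] a(4) show ?thesis
      by (simp add: algebra_simps d_def)
  qed
  from sum_mono[OF this]
  have "(\<Sum>t\<in>UNIV. slot P * (e_cloud P t * yB_cloud r' t - a_cloud P t * yS_cloud r' t)) \<le>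
      (\<Sum>t\<in>UNIV. slot P * (e_cloud P t * yB_cloud r t - a_cloud P t * yS_cloud r t)) +
      (reserve_cost P s - reserve_cost P s')"
    by (simp add: sum.distrib sum_subtractf reserve_cost_def same)
  then show "second_cost P r' \<le> second_cost P r + (reserve_cost P s - reserve_cost P s')"
    unfolding second_cost_def zp same Qcost using X by linarith
qed

text \<open>A master point with its numbered recourse copies is a single real function on the variables
  below, so that the product topology makes boxes compact.\<close>

datatype ('i, 'j, 't) mp_var =
    SE 'j 't | SC 't
  | QE nat 'j 'j 't | QC nat 'j 't | ZP nat 'j 't | XE nat 'i 'j 't | XC nat 'i 't
  | BE nat 'j 't | BC nat 't | YE nat 'j 't | YC nat 't

definition dec_s :: "(('i, 'j, 't) mp_var \<Rightarrow> real) \<Rightarrow> ('j, 't) first_stage" where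
  "dec_s v = \<lparr>s_edge = \<lambda>j t. v (SE j t), s_cloud = \<lambda>t. v (SC t)\<rparr>"

definition dec_r :: "(('i, 'j, 't) mp_var \<Rightarrow> real) \<Rightarrow> nat \<Rightarrow> ('i, 'j, 't) recourse" where
  "dec_r v l =
    \<lparr>q_edge = \<lambda>m j t. v (QE l m j t), q_cloud = \<lambda>j t. v (QC l j t), z_plc = \<lambda>j t. v (ZP l j t),
     x_edge = \<lambda>i j t. v (XE l i j t), x_cloud = \<lambda>i t. v (XC l i t),
     yB_edge = \<lambda>j t. v (BE l j t), yB_cloud = \<lambda>t. v (BC l t),
     yS_edge = \<lambda>j t. v (YE l j t), yS_cloud = \<lambda>t. v (YC l t)\<rparr>"

fun enc :: "('j, 't) first_stage \<Rightarrow> (nat \<Rightarrow> ('i, 'j, 't) recourse) \<Rightarrow> ('i, 'j, 't) mp_var \<Rightarrow> real" where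
  "enc s r (SE j t) = s_edge s j t"
| "enc s r (SC t) = s_cloud s t"
| "enc s r (QE l m j t) = q_edge (r l) m j t"
| "enc s r (QC l j t) = q_cloud (r l) j t"
| "enc s r (ZP l j t) = z_plc (r l) j t"
| "enc s r (XE l i j t) = x_edge (r l) i j t"
| "enc s r (XC l i t) = x_cloud (r l) i t"
| "enc s r (BE l j t) = yB_edge (r l) j t"
| "enc s r (BC l t) = yB_cloud (r l) t"
| "enc s r (YE l j t) = yS_edge (r l) j t"
| "enc s r (YC l t) = yS_cloud (r l) t"

lemma dec_enc [simp]: "dec_s (enc s r) = s" "dec_r (enc s r) l = r l"
  by (simp_all add: dec_s_def dec_r_def)

lemma continuous_z_prev [continuous_intros]:
  "continuous_on UNIV (\<lambda>v. z_prev P (dec_r v l) j t)"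
  \<comment> \<open>For fixed \<open>t\<close> this is either a constant or a coordinate; the choice
    does not depend on \<open>v\<close>.\<close>
  by (cases "int (period t) - 1 \<le> 0") (simp_all add: z_prev_def at_time_def dec_r_def)

lemma continuous_reserve_cost: "continuous_on UNIV (\<lambda>v. reserve_cost P (dec_s v))"
  unfolding reserve_cost_def by (intro continuous_intros; simp add: dec_s_def)

lemma continuous_second_cost: "continuous_on UNIV (\<lambda>v. second_cost P (dec_r v l))"
  unfolding second_cost_def
  by (intro continuous_intros; simp add: dec_r_def)

lemma closed_Omega1: "closed {v. dec_s v \<in> Omega1 P}"
  unfolding Omega1_def mem_Collect_eq
  by (intro closed_Collect_conj closed_Collect_all closed_Collect_le continuous_intros;
      simp add: dec_s_def)

text \<open>A binary constraint is a disjunction of two equations, hence closed; the rest are weak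
  inequalities between continuous functions.\<close>

lemma closed_Omega2: "closed {v. dec_r v l \<in> Omega2 P (dec_s v) lam}"
  unfolding Omega2_def mem_Collect_eq insert_iff empty_iff
  by (intro closed_Collect_conj closed_Collect_all closed_Collect_imp closed_Collect_disj
      closed_Collect_const open_Collect_const closed_Collect_eq closed_Collect_le continuous_intros;
      simp add: dec_s_def dec_r_def)

text \<open>Tychonoff's theorem, which covers the infinite index type \<open>mp_var\<close> with its
  copy numbers of type \<open>nat\<close>.\<close>

lemma compact_box_fun: "compact {v :: 'a \<Rightarrow> real. \<forall>x. v x \<in> {a..b}}"
proof -
  have "{v :: 'a \<Rightarrow> real. \<forall>x. v x \<in> {a..b}} = PiE UNIV (\<lambda>_. {a..b})"
    by auto
  moreover have "compactin (product_topology (\<lambda>_. euclidean) UNIV) (PiE UNIV (\<lambda>_::'a. {a..b}))"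
    by (subst compactin_PiE) auto
  ultimately show ?thesis
    by (simp add: euclidean_product_topology)
qed

lemma continuous_on_Max:
  fixes f :: "'i \<Rightarrow> 'a::topological_space \<Rightarrow> real"
  assumes "finite I" "I \<noteq> {}" "\<And>i. i \<in> I \<Longrightarrow> continuous_on S (f i)"
  shows "continuous_on S (\<lambda>x. Max ((\<lambda>i. f i x) ` I))"
  using assms
proof (induction I rule: finite_ne_induct)
  case (insert i I)
  then show ?case
    by (auto intro!: continuous_on_max)
qed auto

text \<open>For fixed decisions the least admissible \<eta> is the largest copy cost, which is
  continuous. Every feasible point is matched or beaten by one in the compact set \<open>K\<close>,
  so a minimum over \<open>K\<close> is global. An empty list would leave \<eta> unbounded
  below.\<close>

lemma MP_optimal_exists:
  fixes P :: "('i::finite, 'j::finite, 't::{finite,linorder}) edge_instance"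
  assumes P: "valid_instance P" and ne: "lams \<noteq> []"
  obtains s \<eta> rs where "MP_optimal P lams s \<eta> rs"
proof -
  define k where "k = length lams"
  have k0: "k > 0" "{..<k} \<noteq> {}"
    using ne by (auto simp: k_def)
  \<comment> \<open>A crude common bound on all listed demands, nonnegative by construction.\<close>
  define L where "L = (\<Sum>l<k. \<Sum>i\<in>UNIV. \<Sum>t\<in>UNIV. \<bar>lams ! l $ i $ t\<bar>)"
  have L0: "0 \<le> L"
    by (auto simp: L_def intro!: sum_nonneg)
  have lamL: "lams ! l $ i $ t \<le> L" if "l < k" for l i t
  proof -
    have "\<bar>lams ! l $ i $ t\<bar> \<le> (\<Sum>t\<in>UNIV. \<bar>lams ! l $ i $ t\<bar>)"
      by (rule member_le_sum) auto
    also have "\<dots> \<le> (\<Sum>i\<in>UNIV. \<Sum>t\<in>UNIV. \<bar>lams ! l $ i $ t\<bar>)"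
      by (rule member_le_sum[of i]) (auto intro!: sum_nonneg)
    also have "\<dots> \<le> L"
      unfolding L_def using that by (intro member_le_sum[of l]) (auto intro!: sum_nonneg)
    finally show ?thesis
      by linarith
  qed
  define M where "M = res_req P * (real CARD('i) * L)"
  have M0: "0 \<le> M"
    using P L0 by (simp add: M_def valid_instance_def)
  have C0: "0 \<le> capac P j" for j
    using P by (simp add: valid_instance_def)
  \<comment> \<open>One bound for every coordinate: 1 for binaries, \<open>L\<close> for workloads,
    \<open>M\<close> for cloud amounts, capacities for edge amounts.\<close>
  define B where "B = 1 + L + M + (\<Sum>j\<in>UNIV. capac P j)"
  have CB: "capac P j + 1 + L + M \<le> B" for j
    using C0 member_le_sum[of j UNIV "capac P"] by (simp add: B_def)
  have B: "1 \<le> B" "L \<le> B" "M \<le> B" "0 \<le> B" "capac P j \<le> B" for j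
    using L0 M0 C0[of j] CB[of j] by linarith+
  define K where "K = {v :: ('i, 'j, 't) mp_var \<Rightarrow> real. \<forall>x. v x \<in> {0..B}} \<inter>
    ({v. dec_s v \<in> Omega1 P} \<inter> (\<Inter>l\<in>{..<k}. {v. dec_r v l \<in> Omega2 P (dec_s v) (lams ! l)}))"
  define G where "G v = Max ((\<lambda>l. second_cost P (dec_r v l)) ` {..<k})"
    for v :: "('i, 'j, 't) mp_var \<Rightarrow> real"
  have "compact K"
    unfolding K_def by (intro compact_Int_closed compact_box_fun closed_Int closed_INT closed_Omega1 ballI closed_Omega2)
  have "continuous_on K (\<lambda>v. reserve_cost P (dec_s v) + G v)"
    unfolding G_def using k0
    by (intro continuous_on_add continuous_on_Max continuous_on_subset[OF continuous_reserve_cost]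
        continuous_on_subset[OF continuous_second_cost]) auto
  have feas: "MP_feasible P lams (dec_s v) (G v) (map (dec_r v) [0..<k])" if "v \<in> K" for v
    using that by (auto simp: MP_feasible_def K_def G_def list_all2_conv_all_nth k_def)
  have improve: "\<exists>v\<in>K. reserve_cost P (dec_s v) + G v \<le> reserve_cost P s + \<eta>"
    if "MP_feasible P lams s \<eta> rs" for s \<eta> rs
  proof -
    have s: "s \<in> Omega1 P" and len: "length rs = k"
      and rs: "\<And>l. l < k \<Longrightarrow> second_cost P (rs ! l) \<le> \<eta>"
        "\<And>l. l < k \<Longrightarrow> rs ! l \<in> Omega2 P s (lams ! l)"
      using that by (auto simp: MP_feasible_def list_all2_conv_all_nth k_def)
    define s' where "s' = s\<lparr>s_cloud := \<lambda>t. min (s_cloud s t) M\<rparr>"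
    define tr where "tr r = r\<lparr>q_edge := \<lambda>m j t. if m = j then 0 else q_edge r m j t,
      x_edge := \<lambda>i j t. min (x_edge r i j t) L,
      x_cloud := \<lambda>i t. min (x_cloud r i t) L,
      yB_cloud := \<lambda>t. min (yB_cloud r t) M,
      yS_cloud := \<lambda>t. max 0 (yS_cloud r t - (s_cloud s t - s_cloud s' t))\<rparr>"
      for r :: "('i, 'j, 't) recourse"
    define zero :: "('i, 'j, 't) recourse" where "zero = dec_r (\<lambda>_. 0) 0"
    \<comment> \<open>The box restricts copies of every number, so those from \<open>k\<close> on
      are filled with zeros.\<close>
    define r' where "r' l = (if l < k then tr (rs ! l) else zero)" for l
    define v where "v = enc s' r'"
    note tr = truncate_master_point[OF P s L0 M_def s'_def rs(2) lamL tr_def]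
    have r': "r' l \<in> Omega2 P s' (lams ! l)"
      "second_cost P (r' l) \<le> \<eta> + (reserve_cost P s - reserve_cost P s')" if "l < k" for l
      using tr[of l] rs(1)[of l] that by (auto simp: r'_def)
    have s': "s' \<in> Omega1 P"
      using s M0 by (simp add: s'_def Omega1_def)
    have s'b: "0 \<le> s_edge s' j t" "s_edge s' j t \<le> B" "0 \<le> s_cloud s' t" "s_cloud s' t \<le> B" for j t
      using s' B(3) B(5)[of j] by (auto simp: Omega1_def s'_def intro: order_trans)
    have "v x \<in> {0..B}" for x
    proof -
      have z: "zero = \<lparr>q_edge = \<lambda>_ _ _. 0, q_cloud = \<lambda>_ _. 0, z_plc = \<lambda>_ _. 0,
        x_edge = \<lambda>_ _ _. 0, x_cloud = \<lambda>_ _. 0, yB_edge = \<lambda>_ _. 0, yB_cloud = \<lambda>_. 0,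
        yS_edge = \<lambda>_ _. 0, yS_cloud = \<lambda>_. 0\<rparr>"
        by (simp add: zero_def dec_r_def)
      have q: "q_edge (r' l) m j t \<in> {0, 1}" "q_cloud (r' l) j t \<in> {0, 1}"
        "z_plc (r' l) j t \<in> {0, 1}" for l m j t
        using r'(1)[of l] by (cases "l < k"; cases "m = j"; auto simp: Omega2_def r'_def tr_def z)+
      have x: "x_edge (r' l) i j t \<in> {0..L}" "x_cloud (r' l) i t \<in> {0..L}" for l i j t
        using r'(1)[of l] L0 by (cases "l < k"; auto simp: Omega2_def r'_def tr_def z)+
      have y: "yB_cloud (r' l) t \<in> {0..M}" for l t
        using r'(1)[of l] M0 by (cases "l < k"; auto simp: Omega2_def r'_def tr_def z)
      have y': "0 \<le> yS_cloud (r' l) t" "yS_cloud (r' l) t \<le> s_cloud s' t"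
        "0 \<le> yS_edge (r' l) j t" "yS_edge (r' l) j t \<le> s_edge s' j t" for l j t
        using r'(1)[of l] s'b(1)[of j t] s'b(3)[of t] by (cases "l < k"; auto simp: Omega2_def r'_def z)+
      have y'': "0 \<le> yB_edge (r' l) j t" "yB_edge (r' l) j t \<le> capac P j" for l j t
      proof -
        show "0 \<le> yB_edge (r' l) j t"
          using r'(1)[of l] by (cases "l < k"; auto simp: Omega2_def r'_def z)
        \<comment> \<open>Purchases are bounded since the net reservation is at most the capacity
          and the sale at most the reservation.\<close>
        have "capac P j * z_plc (r' l) j t \<le> capac P j"
          using q(3)[of l j t] C0[of j] by auto
        then show "yB_edge (r' l) j t \<le> capac P j"
        proof (cases "l < k")
          case True
          then have "s_edge s' j t + yB_edge (r' l) j t - yS_edge (r' l) j t \<le> capac P j * z_plc (r' l) j t"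
            using r'(1)[of l] by (simp add: Omega2_def)
          with \<open>capac P j * _ \<le> _\<close> y'(4)[of l j t] show ?thesis
            by linarith
        qed (use C0[of j] in \<open>simp add: r'_def z\<close>)
      qed
      have q': "q_edge (r' l) m j t \<in> {0..B}" "q_cloud (r' l) j t \<in> {0..B}"
        "z_plc (r' l) j t \<in> {0..B}" for l m j t
        using q(1)[of l m j t] q(2,3)[of l j t] B by auto
      have x': "x_edge (r' l) i j t \<in> {0..B}" "x_cloud (r' l) i t \<in> {0..B}"
        "yB_cloud (r' l) t \<in> {0..B}" for l i j t
        using x(1)[of l i j t] x(2)[of l i t] y[of l t] B(2,3) by auto
      have y3: "yS_cloud (r' l) t \<le> B" "yS_edge (r' l) j t \<le> B" "yB_edge (r' l) j t \<le> B" for l j t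
        using y'(2)[of l t] y'(4)[of l j t] y''(2)[of l j t] s'b(2)[of j t] s'b(4)[of t] B(5)[of j]
        by linarith+
      show ?thesis
        using q' x' y'(1,3) y''(1) y3 s'b unfolding v_def by (cases x) simp_all
    qed
    then have "v \<in> K"
      using s' r' by (auto simp: K_def v_def)
    \<comment> \<open>The possible rise in recourse cost is offset exactly by the reservation
      savings.\<close>
    moreover have "G v \<le> \<eta> + (reserve_cost P s - reserve_cost P s')"
      using r'(2) k0 by (auto simp: G_def v_def)
    ultimately show ?thesis
      by (intro bexI[of _ v]) (auto simp: v_def)
  qed
  have "K \<noteq> {}"
  proof -
    define s :: "('j, 't) first_stage" where "s = \<lparr>s_edge = \<lambda>_ _. 0, s_cloud = \<lambda>_. 0\<rparr>"
    have s: "s \<in> Omega1 P"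
      using C0 by (simp add: s_def Omega1_def)
    define r where "r lam = (SOME r. r \<in> Omega2 P s lam)" for lam
    have r: "r lam \<in> Omega2 P s lam" for lam
      unfolding r_def using Omega2_nonempty[OF P s, of lam] by (simp add: some_in_eq)
    \<comment> \<open>Zero reservation with arbitrary recourse is feasible once \<eta> is the
      largest cost; \<open>improve\<close> moves it into \<open>K\<close>.\<close>
    have "MP_feasible P lams s (Max ((\<lambda>lam. second_cost P (r lam)) ` set lams)) (map r lams)"
      using s r by (auto simp: MP_feasible_def list_all2_conv_all_nth)
    from improve[OF this] show ?thesis
      by blast
  qed
  then obtain v where v: "v \<in> K"
    "\<And>u. u \<in> K \<Longrightarrow> reserve_cost P (dec_s v) + G v \<le> reserve_cost P (dec_s u) + G u"
    using continuous_attains_inf[OF \<open>compact K\<close> _ \<open>continuous_on K _\<close>] by blast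
  have "MP_optimal P lams (dec_s v) (G v) (map (dec_r v) [0..<k])"
    unfolding MP_optimal_def
  proof (intro conjI allI impI feas v(1))
    fix s \<eta> rs assume "MP_feasible P lams s \<eta> rs"
    from improve[OF this] v(2) show "reserve_cost P (dec_s v) + G v \<le> reserve_cost P s + \<eta>"
      by (meson order_trans)
  qed
  then show thesis ..
qed

section \<open>Bounds from the master problem and the loop invariant\<close>

lemma MP_value_le_objective:
  fixes P :: "('i::finite, 'j::finite, 't::{finite,linorder}) edge_instance"
  assumes opt: "MP_optimal P lams s \<eta> rs" and lams: "set lams \<subseteq> D2 P" and s': "s' \<in> Omega1 P"
  shows "ereal (reserve_cost P s + \<eta>) \<le> objective P s'"
proof (rule ccontr)
  assume "\<not> ?thesis"
  then have "Q P s' < ereal (reserve_cost P s + \<eta> - reserve_cost P s')"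
    by (cases "Q P s'") (auto simp: objective_def)
  \<comment> \<open>The gap lets near-optimal recourse replace minimizers: each listed scenario gets
    a recourse of cost at most \<open>c\<close>, and taking \<eta> as \<open>c\<close> beats the
    master optimum.\<close>
  then obtain c where c: "Q P s' < ereal c" "ereal c < ereal (reserve_cost P s + \<eta> - reserve_cost P s')"
    using ereal_dense2 by blast
  have "\<exists>r\<in>Omega2 P s' lam. second_cost P r \<le> c" if "lam \<in> set lams" for lam
  proof -
    have "recourse_value P s' lam \<le> Q P s'"
      unfolding Q_def using that lams by (intro SUP_upper) auto
    also note c(1)
    finally show ?thesis
      unfolding recourse_value_def by (auto simp: INF_less_iff intro: less_imp_le)
  qed
  then obtain R where R: "\<And>lam. lam \<in> set lams \<Longrightarrow> R lam \<in> Omega2 P s' lam \<and> second_cost P (R lam) \<le> c"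
    by metis
  have "MP_feasible P lams s' c (map R lams)"
    using s' R by (auto simp: MP_feasible_def list_all2_conv_all_nth)
  then have "reserve_cost P s + \<eta> \<le> reserve_cost P s' + c"
    using opt by (auto simp: MP_optimal_def)
  with c(2) show False
    by simp
qed

lemma MP_value_ge_recourse:
  assumes "MP_feasible P lams s \<eta> rs" "lam \<in> set lams"
  shows "recourse_value P s lam \<le> ereal \<eta>"
proof -
  obtain r where "r \<in> Omega2 P s lam" "second_cost P r \<le> \<eta>"
    using assms by (auto simp: MP_feasible_def list_all2_conv_all_nth in_set_conv_nth)
  then show ?thesis
    unfolding recourse_value_def by (auto intro!: INF_lower2)
qed

text \<open>After \<open>n\<close> iterations the list has \<open>n\<close> scenarios besides the
  initial one. A lower bound other than \<infinity> ensures that equal bounds are attained by a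
  trial. Distinctness is restricted to unconverged states because the last oracle answer may be a
  repetition.\<close>

definition outer_invariant ::
  "('i::finite, 'j::finite, 't::{finite,linorder}) edge_instance \<Rightarrow> nat \<Rightarrow> ('i, 'j, 't) outer_state \<Rightarrow> bool" where
  "outer_invariant P n st \<longleftrightarrow>
     length (scens st) = Suc n \<and> set (scens st) \<subseteq> Dstar P \<and> set (trials st) \<subseteq> Omega1 P \<and>
     (\<forall>s\<in>Omega1 P. LB_outer st \<le> objective P s) \<and>
     LB_outer st \<noteq> \<infinity> \<and>
     (UB_outer st = \<infinity> \<or> (\<exists>s\<in>set (trials st). objective P s = UB_outer st)) \<and>
     (\<not> converged st \<longrightarrow> distinct (scens st))"

lemma outer_invariant_init:
  assumes "outer_init P st"
  shows "outer_invariant P 0 st"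
proof -
  obtain lam where "lam \<in> Dstar P"
    "st = \<lparr>scens = [lam], LB_outer = -\<infinity>, UB_outer = \<infinity>, trials = []\<rparr>"
    using assms unfolding outer_init_def by blast
  then show ?thesis
    by (simp add: outer_invariant_def)
qed

lemma outer_invariant_step:
  fixes P :: "('i::finite, 'j::finite, 't::{finite,linorder}) edge_instance"
  assumes inv: "outer_invariant P n st" and step: "outer_step P st st'"
  shows "outer_invariant P (Suc n) st'"
proof -
  obtain s \<eta> rs lam where opt: "MP_optimal P (scens st) s \<eta> rs"
    and lam: "lam \<in> Dstar P" "recourse_value P s lam = Q P s"
    and st': "st' = \<lparr>scens = scens st @ [lam], LB_outer = ereal (reserve_cost P s + \<eta>),
      UB_outer = min (UB_outer st) (objective P s), trials = trials st @ [s]\<rparr>"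
    and nc: "\<not> converged st"
    using step by (auto simp: outer_step_def objective_def)
  have s: "s \<in> Omega1 P"
    using opt by (auto simp: MP_optimal_def MP_feasible_def)
  have lb: "ereal (reserve_cost P s + \<eta>) \<le> objective P s'" if "s' \<in> Omega1 P" for s'
    using inv Dstar_subset_D2 that by (intro MP_value_le_objective[OF opt]) (auto simp: outer_invariant_def)
  \<comment> \<open>The minimum keeps either the old bound with its earlier trial or the value of
    the new \<open>s\<close>.\<close>
  have ub: "UB_outer st' = \<infinity> \<or> (\<exists>s\<in>set (trials st'). objective P s = UB_outer st')"
    using inv by (auto simp: outer_invariant_def st' min_def)
  have trials: "set (trials st') \<subseteq> Omega1 P"
    using inv s by (simp add: outer_invariant_def st')
  \<comment> \<open>A repeated worst case is already a master constraint, so the upper bound drops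
    to the lower one; it cannot fall below, being \<infinity> or the objective of a trial.\<close>
  have "converged st'" if "lam \<in> set (scens st)"
  proof -
    have "Q P s \<le> ereal \<eta>"
      using opt that lam(2) MP_value_ge_recourse[of P "scens st" s \<eta> rs lam] by (simp add: MP_optimal_def)
    then have "objective P s \<le> ereal (reserve_cost P s) + ereal \<eta>"
      unfolding objective_def by (rule add_left_mono)
    then have "UB_outer st' \<le> LB_outer st'"
      by (simp add: st' min.coboundedI2)
    moreover have "LB_outer st' \<le> objective P s'" if "s' \<in> set (trials st')" for s'
      using that trials lb by (auto simp: st')
    then have "LB_outer st' \<le> UB_outer st'"
      using ub by (elim disjE bexE) (simp, metis)
    ultimately show ?thesis
      by (simp add: converged_def)
  qed
  then have "\<not> converged st' \<longrightarrow> distinct (scens st')"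
    using inv nc by (auto simp: outer_invariant_def st')
  moreover have "length (scens st') = Suc (Suc n)" "set (scens st') \<subseteq> Dstar P"
    using inv lam(1) by (simp_all add: outer_invariant_def st')
  moreover have "\<forall>s\<in>Omega1 P. LB_outer st' \<le> objective P s" "LB_outer st' \<noteq> \<infinity>"
    using lb by (simp_all add: st')
  ultimately show ?thesis
    using trials ub unfolding outer_invariant_def by blast
qed

section \<open>Iteration bound, optimality of the output and progress\<close>

lemma outer_invariant_steps:
  assumes "outer_invariant P 0 st0" "(outer_step P ^^ n) st0 st"
  shows "outer_invariant P n st"
  using assms(2)
proof (induction n arbitrary: st)
  case 0
  with assms(1) show ?case by simp
next
  case (Suc n)
  then show ?case by (auto intro: outer_invariant_step)
qed

text \<open>The count is made one step before the end: a state that still takes a step is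
  unconverged, so its \<open>n\<close> scenarios are distinct.\<close>

lemma outer_steps_le_card_Dstar:
  fixes P :: "('i::finite, 'j::finite, 't::{finite,linorder}) edge_instance"
  assumes "outer_invariant P 0 st0" "(outer_step P ^^ n) st0 st"
  shows "n \<le> card (Dstar P)"
proof (cases n)
  case (Suc m)
  then obtain st1 where st1: "(outer_step P ^^ m) st0 st1" "outer_step P st1 st"
    using assms(2) by auto
  then have "\<not> converged st1"
    by (simp add: outer_step_def)
  with outer_invariant_steps[OF assms(1) st1(1)]
  have "distinct (scens st1)" "length (scens st1) = n" "set (scens st1) \<subseteq> Dstar P"
    by (auto simp: outer_invariant_def Suc)
  then show ?thesis
    using card_mono[OF finite_Dstar] distinct_card by metis
qed simp

text \<open>When the bounds meet, their common value is below every objective and is attained by a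
  trial in \<open>Omega1 P\<close>.\<close>

lemma outer_output_optimal:
  assumes "outer_invariant P n st" "converged st"
  shows "\<exists>s. outer_output P st s" and "outer_output P st s \<Longrightarrow> optimal_P1 P s"
proof -
  have eq: "UB_outer st = LB_outer st"
    using assms(2) by (simp add: converged_def)
  have inv: "\<forall>s\<in>Omega1 P. UB_outer st \<le> objective P s" "set (trials st) \<subseteq> Omega1 P"
    and "UB_outer st \<noteq> \<infinity>"
    and "UB_outer st = \<infinity> \<or> (\<exists>s\<in>set (trials st). objective P s = UB_outer st)"
    using assms(1) unfolding outer_invariant_def eq by blast+
  then show "\<exists>s. outer_output P st s"
    unfolding outer_output_def by blast
  show "optimal_P1 P s" if "outer_output P st s"
    using that inv(1,2) unfolding outer_output_def optimal_P1_def by (metis subsetD)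
qed

lemma outer_step_exists:
  fixes P :: "('i::finite, 'j::finite, 't::{finite,linorder}) edge_instance"
  assumes P: "valid_instance P" "worst_case_at_extreme_point P"
    and inv: "outer_invariant P n st" and nc: "\<not> converged st"
  shows "\<exists>st'. outer_step P st st'"
proof -
  have "scens st \<noteq> []"
    using inv by (auto simp: outer_invariant_def)
  then obtain s \<eta> rs where opt: "MP_optimal P (scens st) s \<eta> rs"
    using MP_optimal_exists[OF P(1)] by blast
  then have "s \<in> Omega1 P"
    by (simp add: MP_optimal_def MP_feasible_def)
  then obtain lam where lam: "lam \<in> Dstar P"
    "\<And>lam'. lam' \<in> D2 P \<Longrightarrow> recourse_value P s lam' \<le> recourse_value P s lam"
    using P(2) unfolding worst_case_at_extreme_point_def by blast
  \<comment> \<open>The extreme point lies in \<open>D2 P\<close> itself, so the supremum is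
    attained there and the oracle can answer.\<close>
  then have "recourse_value P s lam = Q P s"
    unfolding Q_def using Dstar_subset_D2[of P]
    by (intro antisym SUP_least SUP_upper) auto
  with opt lam(1) nc show ?thesis
    unfolding outer_step_def by blast
qed

lemma outer_init_exists:
  fixes P :: "('i::finite, 'j::finite, 't::{finite,linorder}) edge_instance"
  assumes "valid_instance P" "worst_case_at_extreme_point P"
  shows "\<exists>st0. outer_init P st0"
proof -
  \<comment> \<open>The worst-case hypothesis gives an extreme point only at some first-stage
    decision; zero reservation is one.\<close>
  have "\<lparr>s_edge = \<lambda>_ _. 0, s_cloud = \<lambda>_. 0\<rparr> \<in> Omega1 P"
    using assms(1) by (simp add: Omega1_def valid_instance_def)
  then have "Dstar P \<noteq> {}"
    using assms(2) unfolding worst_case_at_extreme_point_def by blast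
  from total_demand_max_at_Dstar[OF this] show ?thesis
    unfolding outer_init_def by (meson refl)
qed

theorem mainTheorem2:
  fixes P :: "('i::finite, 'j::finite, 't::{finite,linorder}) edge_instance"
  assumes "valid_instance P"
    and "worst_case_at_extreme_point P"
  shows "(\<exists>st0. outer_init P st0) \<and>
    (\<forall>st0 n st. outer_init P st0 \<and> (outer_step P ^^ n) st0 st \<longrightarrow>
       n \<le> card (Dstar P) \<and>
       (if converged st
        then (\<exists>s. outer_output P st s) \<and> (\<forall>s. outer_output P st s \<longrightarrow> optimal_P1 P s)
        else (\<exists>st'. outer_step P st st')))"
proof (intro conjI allI impI)
  show "\<exists>st0. outer_init P st0"
    by (rule outer_init_exists[OF assms])
next
  fix st0 st :: "('i, 'j, 't) outer_state" and n
  assume run: "outer_init P st0 \<and> (outer_step P ^^ n) st0 st"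
  then have init: "outer_invariant P 0 st0"
    by (simp add: outer_invariant_init)
  with run have inv: "outer_invariant P n st"
    by (simp add: outer_invariant_steps)
  show "n \<le> card (Dstar P)"
    using init run by (blast intro: outer_steps_le_card_Dstar)
  show "if converged st
    then (\<exists>s. outer_output P st s) \<and> (\<forall>s. outer_output P st s \<longrightarrow> optimal_P1 P s)
    else (\<exists>st'. outer_step P st st')"
    using outer_output_optimal[OF inv] outer_step_exists[OF assms inv] by simp
qed

end
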